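(* Let $\mathcal{H}_{\mathsf A}$ and $\mathcal{H}_{\mathsf B}$ be finite-dimensional Hilbert spaces, let $X$ be a Hermitian operator on $\mathcal{H}_{\mathsf A}$ and $Y$ a Hermitian operator on $\mathcal{H}_{\mathsf A}\otimes\mathcal{H}_{\mathsf B}$. Then, for real $t$ in a neighborhood of $0$ in which $I+tX$ and $I+tY$ are positive definite, $$\operatorname{tr}\big((I+tX)\star(I+tY)\big)=\operatorname{tr}_{\mathsf A}\big((I+tX)\star\operatorname{tr}_{\mathsf B}(I+tY)\big)+O(t^4)\qquad(t\to0).$$
   Context: For positive definite operators $\rho,\sigma$ on the same finite-dimensional Hilbert space, $\rho\star\sigma=\exp(\log\rho+\log\sigma)$ (matrix exponential and logarithm). If the operators act on different spaces they are first embedded into the smallest common tensor product space by tensoring with identities; thus on the left-hand side $I+tX$ stands for $(I+tX)\otimes I_{\mathsf B}$, whereas on the right-hand side the $\star$-product is taken on $\mathcal{H}_{\mathsf A}$. $\operatorname{tr}_{\mathsf B}$ is the partial trace over $\mathcal{H}_{\mathsf B}$. *)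

theory Defs
  imports "HOL-Analysis.Analysis" "HOL-Library.Landau_Symbols"
begin

(* Operators on a finite-dimensional Hilbert space are represented by their matrices in an
   orthonormal basis indexed by a finite type; the tensor product of the spaces with index types
   'a and 'b is then the space with index type 'a \<times> 'b. *)

definition hermitian :: "complex^'n^'n \<Rightarrow> bool" where
  "hermitian A \<longleftrightarrow> map_matrix cnj (transpose A) = A"

(* On complex^'n the real inner product is the real part of the Hermitian one, and the quadratic
   form of a Hermitian matrix is real, so the condition below is <x, A x> > 0. *)
definition pos_def :: "complex^'n^'n \<Rightarrow> bool" where
  "pos_def A \<longleftrightarrow> hermitian A \<and> (\<forall>x. x \<noteq> 0 \<longrightarrow> 0 < x \<bullet> (A *v x))"

(* The library exp and power are not usable here: multiplication on vec is entrywise. *)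
definition mat_exp :: "complex^'n^'n \<Rightarrow> complex^'n^'n" where
  "mat_exp A = (\<Sum>k. (1 / fact k) *\<^sub>R (((**) A) ^^ k) (mat 1))"

(* exp is a bijection from Hermitian to positive definite matrices, with inverse log; mat_log is
   meaningful on positive definite arguments only. *)
definition mat_log :: "complex^'n^'n \<Rightarrow> complex^'n^'n" where
  "mat_log A = (THE L. hermitian L \<and> mat_exp L = A)"

definition star_prod :: "complex^'n^'n \<Rightarrow> complex^'n^'n \<Rightarrow> complex^'n^'n"
    (infixl \<open>\<star>\<close> 70) where
  "A \<star> B = mat_exp (mat_log A + mat_log B)"

definition tensor :: "complex^'a^'a \<Rightarrow> complex^'b^'b \<Rightarrow> complex^('a \<times> 'b)^('a \<times> 'b)" where
  "tensor A B = (\<chi> p q. A $ fst p $ fst q * B $ snd p $ snd q)"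

definition partial_trace :: "complex^('a \<times> 'b::finite)^('a \<times> 'b) \<Rightarrow> complex^'a^'a" where
  "partial_trace M = (\<chi> i j. \<Sum>k\<in>UNIV. M $ (i, k) $ (j, k))"

end

(* Let exp U = I + tX and exp V = I + tY with U, V = O(t).  By cyclicity of the trace,
   tr exp(U + V) and tr (exp U exp V) have the same terms of degree at most 3 in U, V, hence
   tr ((I + tX) \<star> (I + tY)) = tr ((I + tX) (I + tY)) + O(t^4).  Applying this on A \<otimes> B and, after
   pulling the scalar dim B out of the partial trace, on A, the claim reduces to the exact
   identity tr ((R \<otimes> I) S) = tr (R tr_B S). *)
theory Submission
  imports Defs
begin

text \<open>Degree 3 is where cyclicity stops helping: words of length at most 3 with the same
  numbers of letters U and V are cyclic shifts of one another, whereas UUVV and UVUV are not. The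
  analytic obstacle is \<open>mat_log\<close>, a definite description: the estimate needs logarithms
  near the identity that exist, are unique and have size O(t). Uniqueness rests on that of positive
  definite square roots, applied at every scale 2^(-k); existence on an open mapping argument at 0;
  the size on the second-order remainder of exp. The scalar dim B appears because tr_B (I + tY) is
  close to (dim B) I rather than to I. A positive scalar factor shifts the logarithm by a multiple
  of the identity, which commutes with everything and so passes through \<star>.\<close>

text \<open>Square matrices as a Banach algebra under the operator norm, so that the library \<open>exp\<close> applies.\<close>
typedef 'n cmat = "UNIV :: (complex^'n::finite^'n) set"
  morphisms mat_of Cmat ..

setup_lifting type_definition_cmat

lemma matrix_scaleR_mult [simp]:
  fixes A B :: "complex^'n^'n"
  shows "(r *\<^sub>R A) ** B = r *\<^sub>R (A ** B)" "A ** (r *\<^sub>R B) = r *\<^sub>R (A ** B)"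
  by (simp_all add: matrix_matrix_mult_def vec_eq_iff scaleR_sum_right)

lemma scaleR_matrix_vector_mult:
  fixes A :: "complex^'n^'n"
  shows "(r *\<^sub>R A) *v x = r *\<^sub>R (A *v x)"
  by (simp add: matrix_vector_mult_def vec_eq_iff scaleR_sum_right)

instantiation cmat :: (finite) real_normed_algebra_1
begin

lift_definition zero_cmat :: "'a cmat" is 0 .
lift_definition one_cmat :: "'a cmat" is "mat 1" .
lift_definition uminus_cmat :: "'a cmat \<Rightarrow> 'a cmat" is uminus .
lift_definition plus_cmat :: "'a cmat \<Rightarrow> 'a cmat \<Rightarrow> 'a cmat" is "(+)" .
lift_definition minus_cmat :: "'a cmat \<Rightarrow> 'a cmat \<Rightarrow> 'a cmat" is "(-)" .
lift_definition times_cmat :: "'a cmat \<Rightarrow> 'a cmat \<Rightarrow> 'a cmat" is "(**)" .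
lift_definition scaleR_cmat :: "real \<Rightarrow> 'a cmat \<Rightarrow> 'a cmat" is "scaleR" .
text \<open>The Euclidean norm of the entries gives \<open>mat 1\<close> the square root of the
  dimension, but the class demands 1. The operator norm meets this and is submultiplicative.\<close>

lift_definition norm_cmat :: "'a cmat \<Rightarrow> real" is "\<lambda>A. onorm ((*v) A)" .
definition dist_cmat :: "'a cmat \<Rightarrow> 'a cmat \<Rightarrow> real" where
  "dist_cmat A B = norm (A - B)"
definition sgn_cmat :: "'a cmat \<Rightarrow> 'a cmat" where
  "sgn_cmat A = inverse (norm A) *\<^sub>R A"
definition uniformity_cmat :: "('a cmat \<times> 'a cmat) filter" where
  "uniformity_cmat = (INF e\<in>{0 <..}. principal {(x, y). dist x y < e})"
definition open_cmat :: "'a cmat set \<Rightarrow> bool" where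
  "open_cmat U \<longleftrightarrow> (\<forall>x\<in>U. \<forall>\<^sub>F (x', y) in uniformity. x' = x \<longrightarrow> y \<in> U)"

instance
proof
  fix x y z :: "'a cmat" and a b :: real
  show "dist x y = norm (x - y)" by (simp add: dist_cmat_def)
  show "sgn x = inverse (norm x) *\<^sub>R x" by (simp add: sgn_cmat_def)
  show "(uniformity :: ('a cmat \<times> 'a cmat) filter)
      = (INF e\<in>{0 <..}. principal {(x, y). dist x y < e})"
    by (simp add: uniformity_cmat_def)
  show "open U \<longleftrightarrow> (\<forall>x\<in>U. \<forall>\<^sub>F (x', y) in uniformity. x' = x \<longrightarrow> y \<in> U)"
    for U :: "'a cmat set"
    by (simp add: open_cmat_def)
  show "x + y + z = x + (y + z)" "x + y = y + x" "0 + x = x" "- x + x = 0" "x - y = x + - y"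
    by (transfer, simp)+
  show "a *\<^sub>R (x + y) = a *\<^sub>R x + a *\<^sub>R y" "(a + b) *\<^sub>R x = a *\<^sub>R x + b *\<^sub>R x"
    "a *\<^sub>R b *\<^sub>R x = (a * b) *\<^sub>R x" "1 *\<^sub>R x = x"
    by (transfer, simp add: algebra_simps)+
  show "x * y * z = x * (y * z)" by transfer (simp add: matrix_mul_assoc)
  show "1 * x = x" "x * 1 = x" by (transfer, simp)+
  show "(x + y) * z = x * z + y * z" 
    by transfer (simp add: matrix_matrix_mult_def vec_eq_iff distrib_right sum.distrib)
  show "x * (y + z) = x * y + x * z" by transfer (simp add: matrix_add_ldistrib)
  show "a *\<^sub>R x * y = a *\<^sub>R (x * y)" "x * a *\<^sub>R y = a *\<^sub>R (x * y)" by (transfer, simp)+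
  show "(0 :: 'a cmat) \<noteq> 1" by transfer (simp add: vec_eq_iff mat_def)
  show "norm x = 0 \<longleftrightarrow> x = 0"
    by transfer (subst onorm_eq_0, auto simp: matrix_eq)
  show "norm (x + y) \<le> norm x + norm y"
    using onorm_triangle[of "(*v) (mat_of x)" "(*v) (mat_of y)"]
    by transfer (simp add: matrix_vector_mult_add_rdistrib[symmetric])
  show "norm (a *\<^sub>R x) = \<bar>a\<bar> * norm x"
    using onorm_scaleR[of "(*v) (mat_of x)" a]
    by transfer (simp add: scaleR_matrix_vector_mult[symmetric])
  show "norm (x * y) \<le> norm x * norm y"
    using onorm_compose[of "(*v) (mat_of x)" "(*v) (mat_of y)"]
    by transfer (simp add: o_def matrix_vector_mul_assoc)
  show "norm (1 :: 'a cmat) = 1" by transfer (subst ext[of "(*v) (mat 1)" "\<lambda>x. x"], simp_all add: onorm_id)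
qed

end

text \<open>Each entry is a coordinate of the image of a basis vector, hence at most the operator
  norm. The resulting boundedness of \<open>mat_of\<close> transports completeness and convergent
  series.\<close>

lemma norm_mat_of_le:
  "norm (mat_of (A :: 'n::finite cmat)) \<le> norm A * (real CARD('n))^2"
proof -
  have entry: "norm (mat_of A $ i $ j) \<le> norm A" for i j
  proof -
    have "norm (mat_of A $ i $ j) = norm ((mat_of A *v axis j 1) $ i)"
      by (simp add: matrix_vector_mult_def axis_def if_distrib cong: if_cong)
    also have "\<dots> \<le> norm (mat_of A *v axis j 1)"
      by (rule Finite_Cartesian_Product.norm_nth_le)
    also have "\<dots> \<le> norm A * norm (axis j (1 :: complex))"
      unfolding norm_cmat.rep_eq by (rule onorm) simp
    finally show ?thesis by simp
  qed
  have "norm (mat_of A) \<le> (\<Sum>i\<in>UNIV. norm (mat_of A $ i))"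
    by (simp add: norm_vec_def L2_set_le_sum)
  also have "\<dots> \<le> (\<Sum>i\<in>UNIV. \<Sum>j\<in>UNIV. norm (mat_of A $ i $ j))"
    by (intro sum_mono) (simp add: norm_vec_def L2_set_le_sum)
  also have "\<dots> \<le> (\<Sum>i\<in>(UNIV :: 'n set). \<Sum>j\<in>(UNIV :: 'n set). norm A)"
    by (intro sum_mono entry)
  finally show ?thesis by (simp add: power2_eq_square ac_simps)
qed

lemma bounded_linear_mat_of: "bounded_linear (mat_of :: 'n::finite cmat \<Rightarrow> _)"
  by (rule bounded_linear_intro[OF _ _ norm_mat_of_le])
    (simp_all add: plus_cmat.rep_eq scaleR_cmat.rep_eq)

lemma bounded_linear_Cmat: "bounded_linear (Cmat :: _ \<Rightarrow> 'n::finite cmat)"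
  by (intro linear_conv_bounded_linear[THEN iffD1] linearI)
    (simp_all add: plus_cmat.abs_eq scaleR_cmat.abs_eq)

instance cmat :: (finite) banach
proof
  fix X :: "nat \<Rightarrow> 'a cmat"
  assume "Cauchy X"
  then have "Cauchy (\<lambda>n. mat_of (X n))"
    by (rule bounded_linear.Cauchy[OF bounded_linear_mat_of])
  then obtain L where "(\<lambda>n. mat_of (X n)) \<longlonglongrightarrow> L"
    using Cauchy_convergent convergent_def by blast
  then have "(\<lambda>n. Cmat (mat_of (X n))) \<longlonglongrightarrow> Cmat L"
    by (rule bounded_linear.tendsto[OF bounded_linear_Cmat])
  then show "convergent X"
    by (auto simp: mat_of_inverse convergent_def)
qed

text \<open>A bounded linear map passes through the series, and \<open>mat_of\<close> turns powers
  of the algebra into iterated matrix products. Facts about \<open>exp\<close> reach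
  \<open>mat_exp\<close> by this identity.\<close>

lemma mat_exp_conv_exp: "mat_exp A = mat_of (exp (Cmat A))"
proof -
  have pow: "(((**) A) ^^ k) (mat 1) = mat_of (Cmat A ^ k)" for k
    by (induction k) (simp_all add: one_cmat.rep_eq times_cmat.rep_eq Cmat_inverse)
  show ?thesis
    unfolding mat_exp_def exp_def
    by (subst bounded_linear.suminf[OF bounded_linear_mat_of summable_exp_generic])
      (simp add: pow scaleR_cmat.rep_eq inverse_eq_divide)
qed


subsection \<open>The exponential in Banach algebras\<close>

text \<open>Since \<open>fact (n + k)\<close> is at least \<open>fact n\<close>, the tail is
  dominated termwise by \<open>norm x ^ k\<close> times the series of \<open>exp (norm x)\<close>.
  It serves with \<open>k\<close> equal to 2 for first-order expansions and to 4 for the trace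
  estimate.\<close>

lemma exp_remainder_bound:
  fixes x :: "'a :: {real_normed_algebra_1, banach}"
  shows "norm (exp x - (\<Sum>n<k. x ^ n /\<^sub>R fact n)) \<le> norm x ^ k * exp (norm x)"
proof -
  have "exp x - (\<Sum>n<k. x ^ n /\<^sub>R fact n) = (\<Sum>n. x ^ (n + k) /\<^sub>R fact (n + k))"
    using exp_first_terms[of x k] by simp
  also have "norm \<dots> \<le> (\<Sum>n. norm x ^ k * (norm x ^ n /\<^sub>R fact n))"
  proof (rule norm_suminf_le)
    fix n
    have "norm (x ^ (n + k) /\<^sub>R fact (n + k)) = norm (x ^ (n + k)) / fact (n + k)"
      by (simp add: divide_inverse_commute)
    also have "\<dots> \<le> norm x ^ (n + k) / fact n"
      by (intro frac_le norm_power_ineq fact_mono) simp_all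
    finally show "norm (x ^ (n + k) /\<^sub>R fact (n + k)) \<le> norm x ^ k * (norm x ^ n /\<^sub>R fact n)"
      by (simp add: power_add divide_simps mult.commute)
  qed (intro summable_mult summable_exp_generic)
  also have "\<dots> = norm x ^ k * exp (norm x)"
    unfolding exp_def by (intro suminf_mult summable_exp_generic)
  finally show ?thesis .
qed

text \<open>On the ball of radius \<open>norm x + 1\<close> the real exponential series at that
  radius is a summable majorant, so the partial sums converge uniformly there.\<close>

lemma isCont_exp_banach_algebra:
  fixes x :: "'a :: {real_normed_algebra_1, banach}"
  shows "isCont exp x"
proof -
  let ?S = "ball (0 :: 'a) (norm x + 1)"
  have "uniform_limit ?S (\<lambda>n y. \<Sum>i<n. y ^ i /\<^sub>R fact i) (\<lambda>y. \<Sum>i. y ^ i /\<^sub>R fact i) sequentially"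
  proof (rule Weierstrass_m_test)
    show "norm (y ^ n /\<^sub>R fact n) \<le> (norm x + 1) ^ n /\<^sub>R fact n" if "y \<in> ?S" for n y
    proof -
      have "norm (y ^ n) \<le> (norm x + 1) ^ n"
        using norm_power_ineq[of y n] power_mono[of "norm y" "norm x + 1" n] that by simp
      then show ?thesis by (simp add: divide_simps)
    qed
  qed (rule summable_exp_generic)
  then have "continuous_on ?S (\<lambda>y. \<Sum>i. y ^ i /\<^sub>R fact i)"
    by (rule uniform_limit_theorem[rotated])
      (auto intro!: always_eventually continuous_intros)
  then have "continuous_on ?S exp"
    by (simp add: exp_def[abs_def])
  then show ?thesis
    by (simp add: continuous_on_eq_continuous_at)
qed

lemma has_derivative_exp_0:
  "((exp :: 'a \<Rightarrow> 'a :: {real_normed_algebra_1, banach}) has_derivative (\<lambda>h. h)) (at 0)"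
  unfolding has_derivative_at
proof (intro conjI bounded_linear_ident)
  have lim: "((\<lambda>h :: 'a. norm h * exp (norm h)) \<longlongrightarrow> 0) (at 0)"
    by (auto intro!: tendsto_eq_intros)
  show "(\<lambda>h :: 'a. norm (exp (0 + h) - exp 0 - h) / norm h) \<midarrow>0\<rightarrow> 0"
  proof (rule tendsto_sandwich[OF _ _ tendsto_const lim])
    show "\<forall>\<^sub>F h :: 'a in at 0. norm (exp (0 + h) - exp 0 - h) / norm h \<le> norm h * exp (norm h)"
    proof (rule eventually_at_ball'[THEN eventually_mono, of 1])
      fix h :: 'a
      assume h: "h \<in> ball 0 1 \<and> h \<noteq> 0 \<and> h \<in> UNIV"
      show "norm (exp (0 + h) - exp 0 - h) / norm h \<le> norm h * exp (norm h)"
        using exp_remainder_bound[of h 2] h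
        by (simp add: divide_simps numeral_2_eq_2 diff_diff_eq mult_ac)
    qed simp
  qed simp
qed

text \<open>Cutting \<open>exp\<close> off after degree 3 costs order \<open>r ^ 4\<close>. The
  difference \<open>T (u + v) - T u * T v\<close> of the cubic polynomials is in general only of
  order 2, because of the commutator of \<open>u\<close> and \<open>v\<close>; it becomes small only
  under \<open>\<tau>\<close>.\<close>

lemma trace_exp_add_approx:
  fixes \<tau> :: "'a :: {real_normed_algebra_1, banach} \<Rightarrow> complex"
  assumes lin: "bounded_linear \<tau>" and cyc: "\<And>x y. \<tau> (x * y) = \<tau> (y * x)"
  obtains C where "\<And>u v r. norm u \<le> r \<Longrightarrow> norm v \<le> r \<Longrightarrow> r \<le> 1 \<Longrightarrow>
    norm (\<tau> (exp (u + v)) - \<tau> (exp u * exp v)) \<le> C * r ^ 4"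
proof -
  interpret bounded_linear \<tau> by (rule lin)
  obtain K where K: "0 \<le> K" "\<And>x. norm (\<tau> x) \<le> norm x * K"
    using nonneg_bounded by blast
  define T :: "'a \<Rightarrow> 'a" where "T x = (\<Sum>n<4. x ^ n /\<^sub>R fact n)" for x
  have T: "T x = 1 + x + (1/2) *\<^sub>R (x * x) + (1/6) *\<^sub>R (x * x * x)" for x
    by (simp add: T_def eval_nat_numeral mult.assoc)
  \<comment> \<open>the terms of \<open>T u * T v\<close> of degree at least 4; those of degree at most 3 agree with
    those of \<open>T (u + v)\<close> up to cyclic permutation of the factors\<close>
  define W :: "'a \<Rightarrow> 'a \<Rightarrow> 'a" where
    "W u v = (1/6) *\<^sub>R (u * (v * v * v)) + (1/4) *\<^sub>R ((u * u) * (v * v)) + (1/6) *\<^sub>R ((u * u * u) * v)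
      + (1/12) *\<^sub>R ((u * u) * (v * v * v)) + (1/12) *\<^sub>R ((u * u * u) * (v * v))
      + (1/36) *\<^sub>R ((u * u * u) * (v * v * v))" for u v
  define E where "E x = exp x - T x" for x :: 'a
  have E: "norm (E x) \<le> norm x ^ 4 * exp (norm x)" for x
    unfolding E_def T_def by (rule exp_remainder_bound)
  have main: "\<tau> (T (u + v)) - \<tau> (T u * T v) = - \<tau> (W u v)" for u v
  proof -
    \<comment> \<open>These rules move every \<open>u\<close> to the front of its word, which gives
      all words of length at most 3 with the same letters one normal form.\<close>
    have c: "\<tau> (v * u) = \<tau> (u * v)"
      "\<tau> (u * (v * u)) = \<tau> (u * (u * v))" "\<tau> (v * (u * u)) = \<tau> (u * (u * v))"
      "\<tau> (v * (u * v)) = \<tau> (u * (v * v))" "\<tau> (v * (v * u)) = \<tau> (u * (v * v))"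
      using cyc[of v u] cyc[of u "v * u"] cyc[of v "u * u"] cyc[of "v * u" v] cyc[of "v * v" u]
        cyc[of "u * v" u] cyc[of v "u * v"]
      by (simp_all add: mult.assoc)
    show ?thesis
      unfolding T W_def
      by (simp add: algebra_simps add diff scaleR c) (simp add: scaleR_conv_of_real field_simps)
  qed
  \<comment> \<open>The summands of the constant bound, in this order, \<open>E (u + v)\<close>,
    \<open>E u * exp v\<close>, \<open>T u * E v\<close> and \<open>W u v\<close>; the factor 16 is
    2^4, from \<open>norm (u + v) \<le> 2 * r\<close>.\<close>
  have bound: "norm (\<tau> (exp (u + v)) - \<tau> (exp u * exp v)) \<le> (K * (16 * exp 2 + exp 1 * exp 1 + 3 * exp 1 + 1)) * r ^ 4"
    if r: "norm u \<le> r" "norm v \<le> r" "r \<le> 1" for u v r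
  proof -
    have r0: "0 \<le> r" using r(1) norm_ge_zero[of u] by linarith
    have Er: "norm (E x) \<le> r ^ 4 * exp 1" if "norm x \<le> r" for x
      using E[of x] mult_mono[OF power_mono[OF that, of 4], of "exp (norm x)" "exp 1"] that r r0
      by simp
    have "norm (u + v) \<le> 2 * r"
      using norm_triangle_ineq[of u v] r by linarith
    then have 1: "norm (E (u + v)) \<le> r ^ 4 * (16 * exp 2)"
      using E[of "u + v"] mult_mono[OF power_mono[of "norm (u + v)" "2 * r" 4], of "exp (norm (u + v))" "exp 2"] r r0
      by (simp add: power_mult_distrib)
    have "norm (exp v) \<le> exp 1"
      using norm_exp[of v] exp_le_cancel_iff[of "norm v" 1] r by linarith
    then have 2: "norm (E u * exp v) \<le> r ^ 4 * (exp 1 * exp 1)"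
      using norm_mult_ineq[of "E u" "exp v"] mult_mono[OF Er[OF r(1)], of "norm (exp v)" "exp 1"] r0
      by (simp add: mult.assoc)
    have mono: "norm (x * y) \<le> r ^ (m + n)" if "norm x \<le> r ^ m" "norm y \<le> r ^ n" for x y :: 'a and m n
      using norm_mult_ineq[of x y] mult_mono[OF that] r0 by (simp add: power_add)
    have p: "norm u \<le> r ^ 1" "norm v \<le> r ^ 1" using r by simp_all
    note q = mono[OF p(1) p(1)] mono[OF p(2) p(2)]
    note c = mono[OF q(1) p(1)] mono[OF q(2) p(2)]
    have le1: "r ^ n \<le> 1" for n using r r0 by (simp add: power_le_one)
    have "norm (T u) \<le> 1 + norm u + (1/2) * norm (u * u) + (1/6) * norm (u * u * u)"
      unfolding T by (intro norm_triangle_le add_mono) simp_all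
    also have "\<dots> \<le> 3"
      using r q(1) c(1) le1[of "1+1"] le1[of "1+1+1"] by linarith
    finally have 3: "norm (T u * E v) \<le> r ^ 4 * (3 * exp 1)"
      using norm_mult_ineq[of "T u" "E v"] mult_mono[of "norm (T u)" 3 "norm (E v)", OF _ Er[OF r(2)]] r0
      by simp
    have le4: "r ^ n \<le> r ^ 4" if "4 \<le> n" for n
      using that r r0 by (intro power_decreasing) simp_all
    have "norm (W u v) \<le> (1/6) * norm (u * (v * v * v)) + (1/4) * norm ((u * u) * (v * v))
        + (1/6) * norm ((u * u * u) * v) + (1/12) * norm ((u * u) * (v * v * v))
        + (1/12) * norm ((u * u * u) * (v * v)) + (1/36) * norm ((u * u * u) * (v * v * v))"
      unfolding W_def by (intro norm_triangle_le add_mono) simp_all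
    \<comment> \<open>The coefficients of \<open>W\<close> add up to 7/9, and each of its words has
      degree at least 4.\<close>
    also have "\<dots> \<le> r ^ 4 * 1"
      using mono[OF p(1) c(2)] mono[OF q] mono[OF c(1) p(2)] mono[OF q(1) c(2)] mono[OF c(1) q(2)] mono[OF c]
        le4[of "1+(1+1+1)"] le4[of "1+1+(1+1)"] le4[of "1+1+1+1"] le4[of "1+1+(1+1+1)"]
        le4[of "1+1+1+(1+1)"] le4[of "1+1+1+(1+1+1)"] zero_le_power[OF r0, of 4]
      by linarith
    finally have 4: "norm (W u v) \<le> r ^ 4 * 1" .
    \<comment> \<open>Telescoping: \<open>exp u * exp v - T u * T v\<close> equals
      \<open>E u * exp v + T u * E v\<close>.\<close>
    have "exp (u + v) - exp u * exp v = E (u + v) - E u * exp v - T u * E v + (T (u + v) - T u * T v)"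
      by (simp add: E_def algebra_simps)
    then have "\<tau> (exp (u + v)) - \<tau> (exp u * exp v) =
        \<tau> (E (u + v) - E u * exp v - T u * E v) + (\<tau> (T (u + v)) - \<tau> (T u * T v))"
      by (metis add diff)
    also have "\<dots> = \<tau> (E (u + v) - E u * exp v - T u * E v - W u v)"
      by (simp add: main diff)
    also have "norm \<dots> \<le> norm (E (u + v) - E u * exp v - T u * E v - W u v) * K"
      by (rule K)
    also have "norm (E (u + v) - E u * exp v - T u * E v - W u v) \<le>
        norm (E (u + v)) + norm (E u * exp v) + norm (T u * E v) + norm (W u v)"
      by norm
    also have "\<dots> \<le> r ^ 4 * (16 * exp 2) + r ^ 4 * (exp 1 * exp 1) + r ^ 4 * (3 * exp 1) + r ^ 4 * 1"
      by (intro add_mono 1 2 3 4)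
    finally show ?thesis
      using K(1) by (simp add: mult_right_mono algebra_simps)
  qed
  show ?thesis
    by (rule that[OF bound])
qed

subsection \<open>Exponentials and logarithms of hermitian matrices\<close>

definition mat_adj :: "complex^'n^'m \<Rightarrow> complex^'m^'n" where
  "mat_adj A = map_matrix cnj (transpose A)"

lemma mat_adj_nth [simp]: "mat_adj A $ i $ j = cnj (A $ j $ i)"
  by (simp add: mat_adj_def map_matrix_def transpose_def)

lemma hermitian_iff: "hermitian A \<longleftrightarrow> mat_adj A = A"
  by (simp add: hermitian_def mat_adj_def)

lemma mat_adj_simps [simp]:
  "mat_adj (A + B) = mat_adj A + mat_adj B" "mat_adj (A - B) = mat_adj A - mat_adj B"
  "mat_adj (r *\<^sub>R A) = r *\<^sub>R mat_adj A" "mat_adj (mat_adj A) = A"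
  "mat_adj (mat 1) = mat 1" "mat_adj 0 = 0"
  by (simp_all add: vec_eq_iff mat_def)

lemma mat_adj_mult: "mat_adj (A ** B) = mat_adj B ** mat_adj A"
  by (simp add: vec_eq_iff matrix_matrix_mult_def mult.commute)

lemma hermitian_closed:
  "hermitian (mat 1)" "hermitian A \<Longrightarrow> hermitian B \<Longrightarrow> hermitian (A + B)"
  "hermitian A \<Longrightarrow> hermitian (r *\<^sub>R A)"
  by (simp_all add: hermitian_iff)

lemma bounded_linear_mat_adj: "bounded_linear (mat_adj :: complex^'n^'m \<Rightarrow> _)"
  by (intro linear_conv_bounded_linear[THEN iffD1] linearI) simp_all

lemma mat_exp_adj: "mat_adj (mat_exp A) = mat_exp (mat_adj A)"
proof -
  have pow: "mat_adj (mat_of (Cmat A ^ k)) = mat_of (Cmat (mat_adj A) ^ k)" for k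
  proof (induction k)
    case (Suc k)
    then show ?case
      \<comment> \<open>The adjoint reverses products, so the new factor is split off on the left
        for \<open>A\<close> and on the right for its adjoint.\<close>
      by (simp only: power_Suc[of "Cmat A"] power_Suc2[of "Cmat (mat_adj A)"])
        (simp add: times_cmat.rep_eq mat_adj_mult Cmat_inverse)
  qed (simp add: one_cmat.rep_eq)
  have bl: "bounded_linear (\<lambda>A. mat_adj (mat_of A))"
    by (rule bounded_linear_compose[OF bounded_linear_mat_adj bounded_linear_mat_of])
  show ?thesis
    using bounded_linear.suminf[OF bl summable_exp_generic, of "Cmat A"]
      bounded_linear.suminf[OF bounded_linear_mat_of summable_exp_generic, of "Cmat (mat_adj A)"]
    by (simp add: mat_exp_conv_exp exp_def scaleR_cmat.rep_eq pow)
qed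

lemma hermitian_mat_exp: "hermitian L \<Longrightarrow> hermitian (mat_exp L)"
  by (simp add: hermitian_iff mat_exp_adj)

lemma mat_exp_add_commuting:
  "A ** B = B ** A \<Longrightarrow> mat_exp (A + B) = mat_exp A ** mat_exp B"
  unfolding mat_exp_conv_exp
  by (simp add: times_cmat.abs_eq plus_cmat.abs_eq[symmetric] exp_add_commuting flip: times_cmat.rep_eq)

lemma mat_exp_0 [simp]: "mat_exp 0 = mat 1"
  by (simp add: mat_exp_conv_exp one_cmat.rep_eq flip: zero_cmat_def)

lemma mat_exp_half: "mat_exp ((1/2) *\<^sub>R A) ** mat_exp ((1/2) *\<^sub>R A) = mat_exp A"
  by (simp add: mat_exp_add_commuting[symmetric] scaleR_left_distrib[symmetric])

lemma mat_exp_minus: "mat_exp (- A) ** mat_exp A = mat 1"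
proof -
  have "(- A) ** A = A ** (- A)"
    by (simp add: matrix_matrix_mult_def vec_eq_iff sum_negf)
  then show ?thesis
    by (simp add: mat_exp_add_commuting[symmetric])
qed

lemma inner_matrix_vector_mult: "x \<bullet> (A *v y) = (mat_adj A *v x) \<bullet> (y :: complex^'n)"
proof -
  have entry: "u \<bullet> (a * v) = Re (cnj u * a * v)" "(cnj a * u) \<bullet> v = Re (cnj u * a * v)" for u a v :: complex
    by (simp_all add: inner_complex_def algebra_simps)
  have "x \<bullet> (A *v y) = (\<Sum>i\<in>UNIV. \<Sum>j\<in>UNIV. Re (cnj (x $ i) * A $ i $ j * y $ j))"
    by (simp only: inner_vec_def matrix_vector_mult_def vec_lambda_beta inner_sum_right entry)
  also have "\<dots> = (\<Sum>j\<in>UNIV. \<Sum>i\<in>UNIV. Re (cnj (x $ i) * A $ i $ j * y $ j))"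
    by (rule sum.swap)
  also have "\<dots> = (mat_adj A *v x) \<bullet> y"
    by (simp only: inner_vec_def matrix_vector_mult_def vec_lambda_beta mat_adj_nth inner_sum_left entry)
  finally show ?thesis .
qed

text \<open>The matrix is the square of the hermitian matrix
  \<open>mat_exp ((1/2) *\<^sub>R L)\<close>, so its quadratic form at \<open>x\<close> is the
  squared length of the image of \<open>x\<close> under that root, and the root is
  invertible.\<close>

lemma pos_def_mat_exp:
  assumes "hermitian L"
  shows "pos_def (mat_exp L)"
  unfolding pos_def_def
proof (intro conjI allI impI)
  show "hermitian (mat_exp L)" using assms by (rule hermitian_mat_exp)
  fix x :: "complex^'a"
  assume x: "x \<noteq> 0"
  let ?H = "mat_exp ((1/2) *\<^sub>R L)"
  have "x \<bullet> (mat_exp L *v x) = x \<bullet> (?H *v (?H *v x))"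
    by (simp add: matrix_vector_mul_assoc mat_exp_half)
  also have "\<dots> = (?H *v x) \<bullet> (?H *v x)"
    using assms by (simp add: inner_matrix_vector_mult mat_exp_adj hermitian_iff)
  finally have *: "x \<bullet> (mat_exp L *v x) = (?H *v x) \<bullet> (?H *v x)" .
  have "mat_exp (- ((1/2) *\<^sub>R L)) *v (?H *v x) = x"
    by (simp only: matrix_vector_mul_assoc mat_exp_minus matrix_vector_mul_lid)
  then have "?H *v x \<noteq> 0" using x by (metis matrix_vector_mult_0_right)
  then show "0 < x \<bullet> (mat_exp L *v x)" by (simp add: *)
qed

lemma matrix_axis_nth: "(A *v axis j 1) $ i = (A $ i $ j :: complex)"
  by (simp add: matrix_vector_mult_def axis_def if_distrib cong: if_cong)

lemma Re_trace_conv_inner: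
  "Re (trace A) = (\<Sum>i\<in>UNIV. axis i 1 \<bullet> (A *v axis i 1))"
proof -
  have "axis i 1 \<bullet> (A *v axis i 1) = Re (A $ i $ i)" for i
    unfolding inner_axis' matrix_axis_nth by (simp add: inner_complex_def)
  then show ?thesis by (simp add: trace_def)
qed

text \<open>With \<open>D = P - Q\<close> one has \<open>P D + D Q = 0\<close>, so the positive numbers \<open>tr (D P D)\<close> and
  \<open>tr (D Q D)\<close> add up to zero.\<close>
lemma pos_def_square_inj:
  assumes P: "pos_def P" and Q: "pos_def Q" and eq: "P ** P = Q ** Q"
  shows "P = Q"
proof -
  define D where "D = P - Q"
  have hD: "mat_adj D = D"
    using P Q by (simp add: D_def pos_def_def hermitian_iff)
  have inner: "axis i 1 \<bullet> ((D ** R ** D) *v axis i 1) = (D *v axis i 1) \<bullet> (R *v (D *v axis i 1))" for R i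
    by (simp add: matrix_vector_mul_assoc[symmetric] inner_matrix_vector_mult[of "axis i 1" D] hD)
  \<comment> \<open>The mixed products cancel and leave \<open>P ** P - Q ** Q\<close>.\<close>
  have "P ** D + D ** Q = 0"
    using eq by (simp add: D_def matrix_matrix_mult_def vec_eq_iff algebra_simps sum_subtractf)
  then have "D ** (P ** D + D ** Q) = 0"
    by (simp add: matrix_matrix_mult_def vec_eq_iff)
  then have "trace (D ** P ** D) + trace (D ** D ** Q) = 0"
    by (simp add: matrix_add_ldistrib matrix_mul_assoc trace_def sum.distrib[symmetric] vec_eq_iff)
  moreover have "trace (D ** D ** Q) = trace (D ** Q ** D)"
    by (metis trace_mul_sym matrix_mul_assoc)
  ultimately have "Re (trace (D ** P ** D)) + Re (trace (D ** Q ** D)) = 0"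
    by (metis plus_complex.sel(1) zero_complex.sel(1))
  moreover have nonneg: "0 \<le> (D *v x) \<bullet> (R *v (D *v x))" if "pos_def R" for R x
    using that by (cases "D *v x = 0") (auto simp: pos_def_def less_imp_le)
  ultimately have "(\<Sum>i\<in>UNIV. (D *v axis i 1) \<bullet> (P *v (D *v axis i 1))) = 0"
    unfolding Re_trace_conv_inner inner
    by (smt (verit) P Q sum_nonneg)
  then have "(D *v axis i 1) \<bullet> (P *v (D *v axis i 1)) = 0" for i
    using nonneg[OF P] by (simp add: sum_nonneg_eq_0_iff)
  then have "D *v axis i 1 = 0" for i
    using P unfolding pos_def_def by (metis less_irrefl)
  then have "D $ i $ j = 0" for i j by (metis matrix_axis_nth zero_index)
  then show ?thesis by (simp add: D_def vec_eq_iff)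
qed

text \<open>Uniqueness of positive definite square roots carries the equality down to the arguments
  scaled by s = 2^(-k). There exp is the identity plus a linear term up to O(s^2), so s times the
  distance of \<open>L\<close> and \<open>M\<close> is O(s^2); dividing by s and letting k grow
  gives equality.\<close>

lemma mat_exp_inj_hermitian:
  assumes L: "hermitian L" and M: "hermitian M" and eq: "mat_exp L = mat_exp M"
  shows "L = M"
proof -
  have halves: "mat_exp ((1/2) ^ k *\<^sub>R L) = mat_exp ((1/2) ^ k *\<^sub>R M)" for k
  proof (induction k)
    case (Suc k)
    show ?case
    proof (rule pos_def_square_inj)
      show "mat_exp ((1/2) ^ Suc k *\<^sub>R L) ** mat_exp ((1/2) ^ Suc k *\<^sub>R L) =
          mat_exp ((1/2) ^ Suc k *\<^sub>R M) ** mat_exp ((1/2) ^ Suc k *\<^sub>R M)"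
        using Suc mat_exp_half[of "(1/2) ^ k *\<^sub>R L"] mat_exp_half[of "(1/2) ^ k *\<^sub>R M"] by simp
    qed (intro pos_def_mat_exp hermitian_closed L M)+
  qed (simp add: eq)
  define l m where "l = Cmat L" and "m = Cmat M"
  have exp_eq: "exp ((1/2) ^ k *\<^sub>R l) = exp ((1/2) ^ k *\<^sub>R m)" for k
    using halves[of k] by (simp add: mat_exp_conv_exp mat_of_inject l_def m_def scaleR_cmat.abs_eq)
  define C where "C = (norm l)\<^sup>2 * exp (norm l) + (norm m)\<^sup>2 * exp (norm m)"
  have "norm (l - m) \<le> (1/2) ^ k * C" for k
  proof -
    define s :: real where "s = (1/2) ^ k"
    have s: "0 < s" "s \<le> 1" by (simp_all add: s_def power_le_one)
    have rem: "norm (exp (s *\<^sub>R x) - 1 - s *\<^sub>R x) \<le> s\<^sup>2 * ((norm x)\<^sup>2 * exp (norm x))" for x :: "'a cmat"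
    proof -
      have "norm (exp (s *\<^sub>R x) - 1 - s *\<^sub>R x) \<le> norm (s *\<^sub>R x) ^ 2 * exp (norm (s *\<^sub>R x))"
        using exp_remainder_bound[of "s *\<^sub>R x" 2] by (simp add: numeral_2_eq_2 diff_diff_eq)
      also have "\<dots> \<le> norm (s *\<^sub>R x) ^ 2 * exp (norm x)"
        using s by (intro mult_left_mono) (simp_all add: mult_left_le_one_le)
      finally show ?thesis using s by (simp add: power_mult_distrib mult.assoc)
    qed
    have "s *\<^sub>R (l - m) = (exp (s *\<^sub>R m) - 1 - s *\<^sub>R m) - (exp (s *\<^sub>R l) - 1 - s *\<^sub>R l)"
      using exp_eq[of k] by (simp add: s_def algebra_simps)
    then have "s * norm (l - m) \<le> norm (exp (s *\<^sub>R m) - 1 - s *\<^sub>R m) + norm (exp (s *\<^sub>R l) - 1 - s *\<^sub>R l)"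
      using norm_triangle_ineq4 s by (metis abs_of_pos norm_scaleR)
    also have "\<dots> \<le> s\<^sup>2 * C"
      using rem[of l] rem[of m] by (simp add: C_def algebra_simps)
    finally show ?thesis
      using s by (simp add: power2_eq_square s_def[symmetric])
  qed
  moreover have "(\<lambda>k. (1/2) ^ k * C) \<longlonglongrightarrow> 0"
    by (rule tendsto_mult_left_zero) (rule LIMSEQ_realpow_zero, simp_all)
  ultimately have "norm (l - m) \<le> 0"
    by (intro LIMSEQ_le_const) auto
  then show ?thesis by (simp add: l_def m_def Cmat_inject)
qed

text \<open>\<open>L\<close> itself is the witness, and injectivity supplies the uniqueness that
  \<open>THE\<close> asks for.\<close>

lemma mat_log_mat_exp: "hermitian L \<Longrightarrow> mat_log (mat_exp L) = L"
  unfolding mat_log_def by (rule the_equality) (auto intro: mat_exp_inj_hermitian)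

text \<open>The exponential, applied to the hermitian part only, is still a local homeomorphism of the
  whole matrix space at 0, so Sussmann's open mapping theorem applies; comparing hermitian
  parts shows that the preimages found are exponentials of hermitian matrices.\<close>
lemma eventually_hermitian_log:
  assumes X: "hermitian X"
  shows "\<forall>\<^sub>F t :: real in nhds 0. \<exists>L. hermitian L \<and> mat_exp L = mat 1 + t *\<^sub>R X \<and>
    norm (Cmat L) \<le> 2 * norm (Cmat X) * \<bar>t\<bar>"
proof -
  define H :: "complex^'a^'a \<Rightarrow> complex^'a^'a" where "H L = (1/2) *\<^sub>R (L + mat_adj L)" for L
  define S :: "complex^'a^'a \<Rightarrow> complex^'a^'a" where "S L = (1/2) *\<^sub>R (L - mat_adj L)" for L
  \<comment> \<open>Adding the skew-hermitian part \<open>S L\<close> makes the derivative at 0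
    equal to \<open>H + S\<close>, the identity of the whole space, while \<open>g\<close> agrees
    with \<open>mat_exp\<close> on hermitian matrices.\<close>
  define g where "g L = mat_exp (H L) + S L" for L
  have H: "hermitian (H L)" for L by (simp add: H_def hermitian_iff add.commute)
  have S: "mat_adj (S L) = - S L" for L by (simp add: S_def algebra_simps)
  have HS: "H L + S L = L" for L by (simp add: H_def S_def scaleR_add_right[symmetric] scaleR_2[symmetric])
  have blH: "bounded_linear H" and blS: "bounded_linear S"
    unfolding H_def[abs_def] S_def[abs_def]
    by (intro bounded_linear_const_scaleR bounded_linear_add bounded_linear_sub
        bounded_linear_ident bounded_linear_mat_adj)+
  have blCH: "bounded_linear (\<lambda>L. Cmat (H L))"
    by (rule bounded_linear_compose[OF bounded_linear_Cmat blH])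
  have g_alt: "g = (\<lambda>L. mat_of (exp (Cmat (H L))) + S L)"
    by (simp add: g_def[abs_def] mat_exp_conv_exp)
  have [simp]: "H 0 = 0" "S 0 = 0" by (simp_all add: H_def S_def)
  have cont: "continuous_on UNIV g"
    unfolding g_alt continuous_on_eq_continuous_at[OF open_UNIV]
    by (auto intro!: continuous_add bounded_linear.isCont[OF bounded_linear_mat_of]
        isCont_o2[OF bounded_linear.isCont[OF blCH] isCont_exp_banach_algebra] continuous_ident
        bounded_linear.isCont[OF blS])
  have contCH: "continuous_on UNIV (\<lambda>L. norm (Cmat (H L)))"
    by (intro continuous_on_norm bounded_linear.continuous_on[OF blCH] continuous_on_id)
  have "((\<lambda>L. mat_of (exp (Cmat (H L))) + S L) has_derivative
      (\<lambda>h. mat_of (Cmat (H h)) + S h)) (at 0)"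
  proof (intro has_derivative_add bounded_linear.has_derivative[OF bounded_linear_mat_of]
      bounded_linear_imp_has_derivative[OF blS])
    have "((\<lambda>L. Cmat (H L)) has_derivative (\<lambda>L. Cmat (H L))) (at 0)"
      by (rule bounded_linear_imp_has_derivative[OF blCH])
    moreover have "(exp has_derivative (\<lambda>h. h)) (at (Cmat (H 0)))"
      using has_derivative_exp_0 by (simp flip: zero_cmat_def)
    ultimately show "((\<lambda>L. exp (Cmat (H L))) has_derivative (\<lambda>h. Cmat (H h))) (at 0)"
      by (rule has_derivative_compose)
  qed
  then have deriv: "(g has_derivative id) (at 0)"
    by (simp add: g_alt Cmat_inverse HS id_def)
  \<comment> \<open>The radius 1/8 gives \<open>norm l * exp (norm l) \<le> 3/8\<close> below, so
    \<open>norm l\<close> is at most 8/5 of the norm of \<open>t *\<^sub>R Cmat X\<close>; this is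
    rounded up to the factor 2.\<close>
  define T where "T = {L. norm (Cmat (H L)) < 1/8}"
  have "open T"
    unfolding T_def by (rule open_Collect_less[OF contCH continuous_on_const])
  moreover have "0 \<in> T" by (simp add: T_def flip: zero_cmat_def)
  ultimately have "g 0 \<in> interior (g ` T)"
    by (intro sussmann_open_mapping[OF open_UNIV cont _ deriv bounded_linear_ident[folded id_def]])
      (simp_all add: interior_open)
  moreover have "g 0 = mat 1 + 0 *\<^sub>R X" by (simp add: g_def)
  moreover have "((\<lambda>t. mat 1 + t *\<^sub>R X) \<longlongrightarrow> mat 1 + 0 *\<^sub>R X) (nhds 0)"
    by (intro tendsto_intros filterlim_ident)
  ultimately have "\<forall>\<^sub>F t in nhds 0. mat 1 + t *\<^sub>R X \<in> interior (g ` T)"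
    by (metis open_interior topological_tendstoD)
  then show ?thesis
  proof eventually_elim
    case (elim t)
    then obtain L where L: "L \<in> T" "g L = mat 1 + t *\<^sub>R X"
      using interior_subset by fastforce
    \<comment> \<open>Both \<open>g L\<close> and \<open>mat_exp (H L)\<close> are hermitian, so
      their difference \<open>S L\<close> is hermitian as well as skew-hermitian, hence 0.\<close>
    have "mat_adj (g L) = g L" using L X by (simp add: hermitian_iff)
    then have "- S L = S L"
      using hermitian_mat_exp[OF H, of L] by (simp add: g_def hermitian_iff S)
    then have "S L = 0" by (simp add: vec_eq_iff)
    then have exp: "mat_exp (H L) = mat 1 + t *\<^sub>R X" using L by (simp add: g_def)
    define l where "l = Cmat (H L)"
    have l: "norm l < 1/8" using L by (simp add: T_def l_def)
    then have "exp (norm l) \<le> exp 1" by simp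
    then have exp3: "exp (norm l) \<le> 3" using exp_le by linarith
    have "exp l = 1 + t *\<^sub>R Cmat X"
      using exp unfolding mat_exp_conv_exp l_def
      by (metis mat_of_inverse one_cmat.abs_eq plus_cmat.abs_eq scaleR_cmat.abs_eq)
    then have "norm (t *\<^sub>R Cmat X - l) \<le> norm l ^ 2 * exp (norm l)"
      using exp_remainder_bound[of l 2] by (simp add: numeral_2_eq_2)
    also have "\<dots> = norm l * (norm l * exp (norm l))"
      by (simp add: power2_eq_square)
    also have "\<dots> \<le> norm l * ((1/8) * 3)"
      using l exp3 by (intro mult_left_mono mult_mono) auto
    finally have "norm l \<le> norm (t *\<^sub>R Cmat X) + norm l * (3/8)"
      using norm_triangle_ineq3[of l "t *\<^sub>R Cmat X"] by (simp add: norm_minus_commute)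
    then have "norm l \<le> 2 * norm (t *\<^sub>R Cmat X)"
      using norm_ge_zero[of l] by linarith
    then show ?case
      using H exp by (auto simp: l_def ac_simps intro!: exI[of _ "H L"])
  qed
qed

text \<open>Near 0 the matrix is the exponential of a hermitian one.\<close>

lemma eventually_pos_def:
  assumes "hermitian X"
  shows "\<forall>\<^sub>F t :: real in nhds 0. pos_def (mat 1 + t *\<^sub>R X)"
  using eventually_hermitian_log[OF assms]
  by eventually_elim (metis pos_def_mat_exp)

subsection \<open>The star product\<close>

text \<open>The trace estimate is applied to the logarithms, whose exponentials are the two given
  factors. The index type is left general, to serve on both the product space and the first
  factor.\<close>

lemma trace_star_prod_approx:
  assumes X: "hermitian X" and Y: "hermitian Y"
  obtains C where "\<forall>\<^sub>F t :: real in nhds 0.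
    norm (trace ((mat 1 + t *\<^sub>R X) \<star> (mat 1 + t *\<^sub>R Y)) - trace ((mat 1 + t *\<^sub>R X) ** (mat 1 + t *\<^sub>R Y)))
      \<le> C * t ^ 4"
proof -
  have lin: "bounded_linear (\<lambda>A :: 'a cmat. trace (mat_of A))"
  proof (rule bounded_linear_compose[OF _ bounded_linear_mat_of])
    show "bounded_linear (trace :: complex^'a^'a \<Rightarrow> complex)"
      by (intro linear_conv_bounded_linear[THEN iffD1] linearI)
        (simp_all add: trace_def sum.distrib scaleR_sum_right)
  qed
  obtain C where C: "\<And>u v r. norm u \<le> r \<Longrightarrow> norm v \<le> r \<Longrightarrow> r \<le> 1 \<Longrightarrow>
      norm (trace (mat_of (exp (u + v))) - trace (mat_of (exp u * exp v :: 'a cmat))) \<le> C * r ^ 4"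
    by (rule trace_exp_add_approx[OF lin]) (auto simp: times_cmat.rep_eq intro: trace_mul_sym)
  \<comment> \<open>\<open>K * \<bar>t\<bar>\<close> dominates the bounds of both logarithms, so it
    can be the common radius \<open>r\<close>.\<close>
  define K where "K = 2 * norm (Cmat X) + 2 * norm (Cmat Y)"
  have "((\<lambda>t. K * \<bar>t\<bar>) \<longlongrightarrow> K * \<bar>0\<bar>) (nhds 0)"
    by (intro tendsto_intros filterlim_ident)
  then have "\<forall>\<^sub>F t in nhds 0. K * \<bar>t\<bar> < 1"
    by (rule order_tendstoD) simp
  then have "\<forall>\<^sub>F t :: real in nhds 0.
      norm (trace ((mat 1 + t *\<^sub>R X) \<star> (mat 1 + t *\<^sub>R Y)) - trace ((mat 1 + t *\<^sub>R X) ** (mat 1 + t *\<^sub>R Y)))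
      \<le> (C * K ^ 4) * t ^ 4"
    using eventually_hermitian_log[OF X] eventually_hermitian_log[OF Y]
  proof eventually_elim
    case (elim t)
    from elim(2) obtain L where L: "hermitian L" "mat_exp L = mat 1 + t *\<^sub>R X"
      "norm (Cmat L) \<le> 2 * norm (Cmat X) * \<bar>t\<bar>" by blast
    from elim(3) obtain M where M: "hermitian M" "mat_exp M = mat 1 + t *\<^sub>R Y"
      "norm (Cmat M) \<le> 2 * norm (Cmat Y) * \<bar>t\<bar>" by blast
    have "mat_log (mat 1 + t *\<^sub>R X) = L" "mat_log (mat 1 + t *\<^sub>R Y) = M"
      using L M by (metis mat_log_mat_exp)+
    then have star: "(mat 1 + t *\<^sub>R X) \<star> (mat 1 + t *\<^sub>R Y) = mat_exp (L + M)"
      by (simp add: star_prod_def)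
    have "norm (Cmat L) \<le> K * \<bar>t\<bar>" "norm (Cmat M) \<le> K * \<bar>t\<bar>"
      using L(3) M(3) by (simp_all add: K_def distrib_right add_increasing add_increasing2)
    from C[OF this] elim(1)
    show ?case
      unfolding star
      by (simp add: L(2)[symmetric] M(2)[symmetric] mat_exp_conv_exp plus_cmat.abs_eq times_cmat.rep_eq power_mult_distrib mult.assoc)
  qed
  then show ?thesis by (rule that)
qed

lemma mat_exp_add_scaleR_one: "mat_exp (A + r *\<^sub>R mat 1) = exp r *\<^sub>R mat_exp A"
proof -
  have "mat_exp (r *\<^sub>R mat 1 :: complex^'a^'a) = exp r *\<^sub>R mat 1"
  proof -
    have "exp (of_real r :: 'a cmat) = of_real (exp r)"
      by (rule exp_of_real)
    then show ?thesis
      by (simp add: mat_exp_conv_exp of_real_def scaleR_cmat.rep_eq one_cmat.rep_eq scaleR_cmat.abs_eq[symmetric]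
          one_cmat.abs_eq[symmetric])
  qed
  then show ?thesis by (simp add: mat_exp_add_commuting)
qed

text \<open>The logarithm of \<open>c *\<^sub>R mat_exp M\<close> is
  \<open>M + ln c *\<^sub>R mat 1\<close>, and the added multiple of the identity leaves the
  exponential again as the factor \<open>c\<close>.\<close>

lemma star_prod_scaleR_right:
  assumes "hermitian L" "hermitian M" "0 < c"
  shows "mat_exp L \<star> (c *\<^sub>R mat_exp M) = c *\<^sub>R (mat_exp L \<star> mat_exp M)"
proof -
  have "c *\<^sub>R mat_exp M = mat_exp (M + ln c *\<^sub>R mat 1)"
    using assms by (simp add: mat_exp_add_scaleR_one)
  moreover have "hermitian (M + ln c *\<^sub>R mat 1)"
    by (intro hermitian_closed assms)
  ultimately have "mat_log (c *\<^sub>R mat_exp M) = M + ln c *\<^sub>R mat 1"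
    by (simp only: mat_log_mat_exp)
  then show ?thesis
    using assms by (simp add: star_prod_def mat_log_mat_exp mat_exp_add_scaleR_one add.assoc[symmetric])
qed

section \<open>Tensoring with the identity and partial traces\<close>

lemma hermitian_tensor_one: "hermitian X \<Longrightarrow> hermitian (tensor X (mat 1))"
  by (simp add: hermitian_iff vec_eq_iff tensor_def mat_def)

lemma hermitian_partial_trace: "hermitian Y \<Longrightarrow> hermitian (partial_trace Y)"
  by (simp add: hermitian_iff vec_eq_iff partial_trace_def)

lemma tensor_one_add:
  "tensor (mat 1 + t *\<^sub>R X) (mat 1) = mat 1 + t *\<^sub>R tensor X (mat 1)"
  by (simp add: vec_eq_iff tensor_def mat_def prod_eq_iff)

text \<open>Factoring out the partial trace of the identity leaves a perturbation of the identity,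
  the form that \<open>trace_star_prod_approx\<close> accepts.\<close>

lemma partial_trace_one_add:
  fixes Y :: "complex^('a::finite \<times> 'b::finite)^('a \<times> 'b)"
  shows "partial_trace (mat 1 + t *\<^sub>R Y) =
    real CARD('b) *\<^sub>R (mat 1 + t *\<^sub>R ((1 / real CARD('b)) *\<^sub>R partial_trace Y))"
  by (simp add: vec_eq_iff partial_trace_def mat_def sum.distrib scaleR_sum_right scaleR_add_right)
    (simp add: scaleR_conv_of_real)

text \<open>The identity in the second factor forces equal second indices, and the remaining sum
  over that index is an entry of the partial trace.\<close>

lemma trace_mult_partial_trace:
  fixes M :: "complex^('a::finite \<times> 'b::finite)^('a \<times> 'b)"
  shows "trace (tensor A (mat 1) ** M) = trace (A ** partial_trace M)"
proof -
  have sum_prod: "(\<Sum>p\<in>UNIV. f p) = (\<Sum>i\<in>UNIV. \<Sum>k\<in>UNIV. f (i, k))" for f :: "'a \<times> 'b \<Rightarrow> complex"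
    by (simp add: sum.cartesian_product)
  have "trace (tensor A (mat 1) ** M) =
      (\<Sum>i\<in>UNIV. \<Sum>k\<in>UNIV. \<Sum>j\<in>UNIV. \<Sum>l\<in>UNIV. A $ i $ j * (if k = l then M $ (j, l) $ (i, k) else 0))"
    by (simp add: trace_def matrix_matrix_mult_def tensor_def mat_def sum_prod if_distrib if_distribR
        cong: if_cong)
  also have "\<dots> = (\<Sum>i\<in>UNIV. \<Sum>k\<in>UNIV. \<Sum>j\<in>UNIV. A $ i $ j * M $ (j, k) $ (i, k))"
    by (simp add: if_distrib cong: if_cong)
  also have "\<dots> = (\<Sum>i\<in>UNIV. \<Sum>j\<in>UNIV. \<Sum>k\<in>UNIV. A $ i $ j * M $ (j, k) $ (i, k))"
    by (intro sum.cong refl sum.swap)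
  also have "\<dots> = trace (A ** partial_trace M)"
    by (simp add: trace_def matrix_matrix_mult_def partial_trace_def sum_distrib_left)
  finally show ?thesis .
qed

theorem theorem3p7:
  fixes X :: "complex^'a^'a"
    and Y :: "complex^('a \<times> 'b::finite)^('a \<times> 'b)"
  assumes "hermitian X" and "hermitian Y"
  shows "(\<forall>\<^sub>F t :: real in nhds 0. pos_def (mat 1 + t *\<^sub>R X) \<and> pos_def (mat 1 + t *\<^sub>R Y)) \<and>
    (\<lambda>t :: real. trace (tensor (mat 1 + t *\<^sub>R X) (mat 1 :: complex^'b^'b) \<star> (mat 1 + t *\<^sub>R Y))
        - trace ((mat 1 + t *\<^sub>R X) \<star> partial_trace (mat 1 + t *\<^sub>R Y)))
      \<in> O[nhds 0](\<lambda>t. complex_of_real (t ^ 4))"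
proof
  show "\<forall>\<^sub>F t :: real in nhds 0. pos_def (mat 1 + t *\<^sub>R X) \<and> pos_def (mat 1 + t *\<^sub>R Y)"
    using assms by (intro eventually_conj eventually_pos_def)
  define d where "d = real CARD('b)"
  have d: "0 < d" by (simp add: d_def)
  define Z where "Z = (1 / d) *\<^sub>R partial_trace Y"
  have Z: "hermitian Z"
    unfolding Z_def by (intro hermitian_closed hermitian_partial_trace assms)
  have ptrace: "partial_trace (mat 1 + t *\<^sub>R Y) = d *\<^sub>R (mat 1 + t *\<^sub>R Z)" for t
    by (simp add: partial_trace_one_add d_def Z_def)
  have trace_scaleR: "trace (r *\<^sub>R A) = r *\<^sub>R trace A" for r and A :: "complex^'a^'a"
    by (simp add: trace_def scaleR_sum_right)
  obtain C1 where C1: "\<forall>\<^sub>F t :: real in nhds 0.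
      norm (trace ((mat 1 + t *\<^sub>R tensor X (mat 1 :: complex^'b^'b)) \<star> (mat 1 + t *\<^sub>R Y))
        - trace ((mat 1 + t *\<^sub>R tensor X (mat 1 :: complex^'b^'b)) ** (mat 1 + t *\<^sub>R Y))) \<le> C1 * t ^ 4"
    by (rule trace_star_prod_approx[OF hermitian_tensor_one[OF assms(1)] assms(2)])
  obtain C2 where C2: "\<forall>\<^sub>F t :: real in nhds 0.
      norm (trace ((mat 1 + t *\<^sub>R X) \<star> (mat 1 + t *\<^sub>R Z))
        - trace ((mat 1 + t *\<^sub>R X) ** (mat 1 + t *\<^sub>R Z))) \<le> C2 * t ^ 4"
    by (rule trace_star_prod_approx[OF assms(1) Z])
  show "(\<lambda>t :: real. trace (tensor (mat 1 + t *\<^sub>R X) (mat 1 :: complex^'b^'b) \<star> (mat 1 + t *\<^sub>R Y))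
        - trace ((mat 1 + t *\<^sub>R X) \<star> partial_trace (mat 1 + t *\<^sub>R Y)))
      \<in> O[nhds 0](\<lambda>t. complex_of_real (t ^ 4))"
  \<comment> \<open>\<open>C1\<close> is the error on the product space; the error \<open>C2\<close>
    on the first factor is multiplied by the scalar \<open>d\<close> taken out of the partial
    trace.\<close>
  proof (rule bigoI[of _ "C1 + d * C2"])
    show "\<forall>\<^sub>F t :: real in nhds 0.
        norm (trace (tensor (mat 1 + t *\<^sub>R X) (mat 1 :: complex^'b^'b) \<star> (mat 1 + t *\<^sub>R Y))
          - trace ((mat 1 + t *\<^sub>R X) \<star> partial_trace (mat 1 + t *\<^sub>R Y)))
        \<le> (C1 + d * C2) * norm (complex_of_real (t ^ 4))"
      using C1 C2 eventually_hermitian_log[OF assms(1)] eventually_hermitian_log[OF Z]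
    proof eventually_elim
      case (elim t)
      define A B where "A = mat 1 + t *\<^sub>R X" and "B = mat 1 + t *\<^sub>R Z"
      \<comment> \<open>The hermitian logarithms of \<open>A\<close> and \<open>B\<close> exhibit
        them as the exponentials that \<open>star_prod_scaleR_right\<close> asks for.\<close>
      have "A \<star> (d *\<^sub>R B) = d *\<^sub>R (A \<star> B)"
        using elim(3,4) d unfolding A_def B_def by (metis star_prod_scaleR_right)
      then have right: "trace (A \<star> partial_trace (mat 1 + t *\<^sub>R Y)) = d *\<^sub>R trace (A \<star> B)"
        by (simp add: ptrace B_def trace_scaleR)
      \<comment> \<open>Here the two spaces meet: \<open>d *\<^sub>R trace (A ** B)\<close> is the
        common value with which both star products are compared.\<close>
      have "trace (tensor A (mat 1) ** (mat 1 + t *\<^sub>R Y)) = d *\<^sub>R trace (A ** B)"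
        by (simp add: trace_mult_partial_trace ptrace B_def trace_scaleR)
      then have left: "norm (trace (tensor A (mat 1 :: complex^'b^'b) \<star> (mat 1 + t *\<^sub>R Y)) - d *\<^sub>R trace (A ** B)) \<le> C1 * t ^ 4"
        using elim(1) by (simp add: A_def tensor_one_add)
      have "norm (trace (tensor A (mat 1 :: complex^'b^'b) \<star> (mat 1 + t *\<^sub>R Y)) - d *\<^sub>R trace (A \<star> B))
          \<le> norm (trace (tensor A (mat 1 :: complex^'b^'b) \<star> (mat 1 + t *\<^sub>R Y)) - d *\<^sub>R trace (A ** B))
            + norm (d *\<^sub>R (trace (A \<star> B) - trace (A ** B)))"
        using norm_triangle_ineq4 [of "trace (tensor A (mat 1 :: complex^'b^'b) \<star> (mat 1 + t *\<^sub>R Y)) - d *\<^sub>R trace (A ** B)"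
            "d *\<^sub>R (trace (A \<star> B) - trace (A ** B))"]
        by (simp add: scaleR_diff_right)
      also have "\<dots> \<le> C1 * t ^ 4 + d * (C2 * t ^ 4)"
        using left elim(2) d by (intro add_mono) (simp_all add: A_def B_def)
      finally show ?case
        unfolding A_def[symmetric] right by (simp add: norm_power distrib_right mult.assoc)
    qed
  qed
qed

end
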